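(* Let $n\ge 1$ and let $f:\{0,1\}^n\to\mathbb{R}$ be a non-zero function, and set $\rho=\frac1n\frac{\mathrm{Ent}(f^2)}{\mathbb{E} f^2}$ (so $\rho\in[0,\log 2]$). Then $$\mathbb{E}_x \sum_{y\sim x}(f(x)-f(y))^2\ \ge\ C(\rho)\cdot \mathrm{Ent}(f^2),$$ where $$C(x)=\frac4x\left(\frac12-\sqrt{H^{-1}(\log 2-x)\big(1-H^{-1}(\log 2-x)\big)}\right),$$ with $C(0)$ understood as the limit $\lim_{x\to 0^+}C(x)=2$. Moreover, the function $C$ is an increasing convex function on $[0,\log 2]$, taking $[0,\log 2]$ onto $[2,2/\log 2]$.
   Context: $\{0,1\}^n$ is the Hamming cube: vertices are binary strings of length $n$, and $x\sim y$ means $x,y$ differ in exactly one coordinate (so each $x$ has $n$ neighbours). $\mathbb{E}$ and $\mathbb{E}_x$ denote expectation with respect to the uniform probability measure on $\{0,1\}^n$. For a nonnegative function $g$, $\mathrm{Ent}(g)=\mathbb{E}\, g\log g-\mathbb{E} g\log \mathbb{E} g$ (with $0\log 0=0$). All logarithms are natural. $H(x)=-x\log x-(1-x)\log(1-x)$ is the natural entropy function, and $H^{-1}$ denotes the inverse of $H$ restricted to $[0,1/2]$, a map from $[0,\log 2]$ onto $[0,1/2]$. *)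

theory Defs
  imports "HOL-Analysis.Analysis" "HOL-Probability.Probability"
begin

definition cube :: "nat \<Rightarrow> bool list set" where
  "cube n = {x. length x = n}"

definition adjacent :: "bool list \<Rightarrow> bool list \<Rightarrow> bool" where
  "adjacent x y \<longleftrightarrow> length x = length y \<and> card {i. i < length x \<and> x ! i \<noteq> y ! i} = 1"

definition neighbours :: "bool list \<Rightarrow> bool list set" where
  "neighbours x = {y. adjacent x y}"

definition cube_expectation :: "nat \<Rightarrow> (bool list \<Rightarrow> real) \<Rightarrow> real" where
  "cube_expectation n g = measure_pmf.expectation (pmf_of_set (cube n)) g"

text \<open>Since \<^term>\<open>(0::real) * t = 0\<close> for every \<^term>\<open>t::real\<close>, the convention
  \<open>0 log 0 = 0\<close> needs no case distinction below, neither in the entropy functional nor in the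
  entropy function.\<close>

definition cube_Ent :: "nat \<Rightarrow> (bool list \<Rightarrow> real) \<Rightarrow> real" where
  "cube_Ent n g = cube_expectation n (\<lambda>x. g x * ln (g x))
     - cube_expectation n g * ln (cube_expectation n g)"

definition nat_entropy :: "real \<Rightarrow> real" where
  "nat_entropy x = - x * ln x - (1 - x) * ln (1 - x)"

definition nat_entropy_inv :: "real \<Rightarrow> real" where
  "nat_entropy_inv = the_inv_into {0..1/2} nat_entropy"

text \<open>The value at \<open>0\<close> is the limit from the right.\<close>

definition logsob_C :: "real \<Rightarrow> real" where
  "logsob_C x = (if x = 0 then 2
     else 4 / x * (1/2 - sqrt (nat_entropy_inv (ln 2 - x) * (1 - nat_entropy_inv (ln 2 - x)))))"

lemma finite_cube [simp]: "finite (cube n)"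
  using finite_lists_length_eq[of "UNIV :: bool set" n] by (simp add: cube_def)

lemma card_cube: "card (cube n) = 2 ^ n"
  using card_lists_length_eq[of "UNIV :: bool set" n] by (simp add: cube_def)

lemma cube_nonempty [simp]: "cube n \<noteq> {}"
  using Ex_list_of_length[of n] by (auto simp: cube_def)

lemma cube_expectation_eq_sum: "cube_expectation n g = (\<Sum>x\<in>cube n. g x) / 2 ^ n"
  by (simp add: cube_expectation_def integral_pmf_of_set card_cube)

end

theory Submission
  imports Defs "HOL-Real_Asymp.Real_Asymp"
begin

text \<open>
  Write \<open>\<Phi> x = x * C x\<close>. On a two-point space the inequality holds for nonnegative functions with
  equality, by the choice of \<open>\<Phi>\<close>. It passes to the cube by induction on the dimension, since the
  perspective \<open>w * \<Phi> (e / w)\<close> of the convex function \<open>\<Phi>\<close> is subadditive.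

  For the shape of \<open>C\<close>, parametrise \<open>H\<^sup>-\<^sup>1(ln 2 - x) = (1 - t) / 2\<close> and put \<open>u = artanh t\<close>.
  Then \<open>dx/dt = u\<close> and \<open>d\<Phi>/dx = 2 * sinh u / u\<close>, and
  \<open>d\<^sup>2\<Phi>/dx\<^sup>2 = 2 * cosh\<^sup>2 u * (u * cosh u - sinh u) / u\<^sup>3\<close>. The monotone form of l'Hopital's rule
  shows in turn that these two derivatives, then \<open>C = \<Phi> / x\<close>, and then
  \<open>C' = (x * \<Phi>' - \<Phi>) / x\<^sup>2\<close>, whose numerator and denominator have derivatives
  in the ratio \<open>\<Phi>'' / 2\<close>, are increasing.
\<close>

section \<open>Mean value arguments\<close>

text \<open>Rolle's theorem for the combination \<open>h\<close> of \<open>f\<close> and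
  \<open>g\<close> that agrees at both ends. Writing the derivative of \<open>f\<close> as
  \<open>r x * g' x\<close> makes \<open>r\<close> the derivative of \<open>f\<close> with respect
  to \<open>g\<close>, which is how all later derivatives are given.\<close>

lemma cauchy_mean_value:
  fixes f g r g' :: "real \<Rightarrow> real"
  assumes "a < b" and cf: "continuous_on {a..b} f" and cg: "continuous_on {a..b} g"
    and df: "\<And>x. a < x \<Longrightarrow> x < b \<Longrightarrow> (f has_real_derivative r x * g' x) (at x)"
    and dg: "\<And>x. a < x \<Longrightarrow> x < b \<Longrightarrow> (g has_real_derivative g' x) (at x)"
    and pos: "\<And>x. a < x \<Longrightarrow> x < b \<Longrightarrow> g' x > 0"
  obtains \<xi> where "a < \<xi>" "\<xi> < b" "f b - f a = r \<xi> * (g b - g a)"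
proof -
  define h where "h x = (f b - f a) * g x - (g b - g a) * f x" for x
  have "\<exists>z. a < z \<and> z < b \<and>
      (\<lambda>x v. ((f b - f a) * g' x - (g b - g a) * (r x * g' x)) * v) z = (\<lambda>v. 0)"
  proof (rule Rolle_deriv[OF \<open>a < b\<close>, of h])
    show "h a = h b"
      by (simp add: h_def algebra_simps)
    show "continuous_on {a..b} h"
      unfolding h_def by (intro continuous_intros cf cg)
    show "(h has_derivative (*) ((f b - f a) * g' x - (g b - g a) * (r x * g' x))) (at x)"
      if "a < x" "x < b" for x
      using DERIV_diff[OF DERIV_cmult[OF dg[OF that], of "f b - f a"]
          DERIV_cmult[OF df[OF that], of "g b - g a"]]
      unfolding has_field_derivative_def h_def .
  qed
  then obtain z where z: "a < z" "z < b"
      and eq: "(\<lambda>v. ((f b - f a) * g' z - (g b - g a) * (r z * g' z)) * v) = (\<lambda>v. 0)"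
    by blast
  have "((f b - f a) - r z * (g b - g a)) * g' z = 0"
    using fun_cong[OF eq, of 1] by (simp add: algebra_simps)
  then have "f b - f a = r z * (g b - g a)"
    using pos[OF z] by simp
  with z show ?thesis
    by (rule that)
qed

text \<open>By the mean value theorem \<open>f x / g x\<close> is some \<open>r \<xi>\<close> with
  \<open>\<xi> < x\<close>, while the increments over \<open>[x, y]\<close> have quotient
  \<open>r \<eta>\<close> with \<open>\<eta> > x\<close>. So \<open>f y / g y\<close> is a mediant
  of a smaller and a larger quotient and exceeds the smaller one.\<close>

lemma monotone_lhopital:
  fixes f g r g' :: "real \<Rightarrow> real"
  assumes axy: "a < x" "x < y"
    and cf: "continuous_on {a..y} f" and cg: "continuous_on {a..y} g"
    and df: "\<And>t. a < t \<Longrightarrow> t < y \<Longrightarrow> (f has_real_derivative r t * g' t) (at t)"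
    and dg: "\<And>t. a < t \<Longrightarrow> t < y \<Longrightarrow> (g has_real_derivative g' t) (at t)"
    and pos: "\<And>t. a < t \<Longrightarrow> t < y \<Longrightarrow> g' t > 0"
    and mono: "strict_mono_on {a<..<y} r"
    and zero: "f a = 0" "g a = 0"
  shows "f x / g x < f y / g y"
proof -
  have inc: "g s < g t" if "a \<le> s" "s < t" "t \<le> y" for s t
  proof (rule DERIV_pos_imp_increasing_open[OF \<open>s < t\<close>])
    show "\<exists>d. (g has_real_derivative d) (at u) \<and> d > 0" if "s < u" "u < t" for u
      using that \<open>a \<le> s\<close> \<open>t \<le> y\<close> dg[of u] pos[of u] by force
    show "continuous_on {s..t} g"
      by (rule continuous_on_subset[OF cg]) (use that in auto)
  qed
  obtain \<xi> where \<xi>: "a < \<xi>" "\<xi> < x" "f x - f a = r \<xi> * (g x - g a)"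
    by (rule cauchy_mean_value[of a x f g r g'])
       (use axy df dg pos in \<open>auto intro: continuous_on_subset[OF cf] continuous_on_subset[OF cg]\<close>)
  obtain \<eta> where \<eta>: "x < \<eta>" "\<eta> < y" "f y - f x = r \<eta> * (g y - g x)"
    by (rule cauchy_mean_value[of x y f g r g'])
       (use axy df dg pos in \<open>auto intro: continuous_on_subset[OF cf] continuous_on_subset[OF cg]\<close>)
  have gx: "0 < g x" and gy: "g x < g y"
    using inc[of a x] inc[of x y] axy zero by auto
  have "r \<xi> < r \<eta>"
    using mono \<xi> \<eta> axy by (auto intro: strict_mono_onD)
  then have "r \<xi> * (g y - g x) < r \<eta> * (g y - g x)"
    using gy by simp
  moreover have fx: "f x = r \<xi> * g x"
    using \<xi> zero by simp
  ultimately have "r \<xi> * g y < f y"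
    using \<eta> by (simp add: algebra_simps)
  then show ?thesis
    using gx gy fx by (simp add: field_simps)
qed

text \<open>Chord slopes of the curve \<open>(X t, F t)\<close> are values of \<open>m\<close> at
  intermediate parameters, so they increase from left to right. The convexity defect at weight
  \<open>s\<close> is \<open>s * (1 - s) * (y - x)\<close> times the difference of two adjacent
  chord slopes. This gives convexity in the entropy variable without differentiating an inverse
  function.\<close>

lemma convex_on_parametric:
  fixes X F X' m G :: "real \<Rightarrow> real"
  assumes "a < b" and cX: "continuous_on {a..b} X" and cF: "continuous_on {a..b} F"
    and dX: "\<And>t. a < t \<Longrightarrow> t < b \<Longrightarrow> (X has_real_derivative X' t) (at t)"
    and dF: "\<And>t. a < t \<Longrightarrow> t < b \<Longrightarrow> (F has_real_derivative m t * X' t) (at t)"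
    and pos: "\<And>t. a < t \<Longrightarrow> t < b \<Longrightarrow> X' t > 0"
    and mono: "mono_on {a<..<b} m"
    and G: "\<And>t. t \<in> {a..b} \<Longrightarrow> G (X t) = F t"
  shows "convex_on {X a..X b} G"
proof (rule convex_on_linorderI)
  fix s x y :: real
  assume s: "0 < s" "s < 1" and xy: "x \<in> {X a..X b}" "y \<in> {X a..X b}" "x < y"
  have inc: "X u < X v" if "a \<le> u" "u < v" "v \<le> b" for u v
  proof (rule DERIV_pos_imp_increasing_open[OF \<open>u < v\<close>])
    show "\<exists>d. (X has_real_derivative d) (at t) \<and> d > 0" if "u < t" "t < v" for t
      using that \<open>a \<le> u\<close> \<open>v \<le> b\<close> dX[of t] pos[of t] by force
    show "continuous_on {u..v} X"
      by (rule continuous_on_subset[OF cX]) (use that in auto)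
  qed
  have surj: "\<exists>t\<in>{a..b}. X t = z" if "z \<in> {X a..X b}" for z
    using IVT'[of X a z b] that \<open>a < b\<close> cX by auto
  define p where "p = (1 - s) * x + s * y"
  have px: "p - x = s * (y - x)" and yp: "y - p = (1 - s) * (y - x)"
    by (simp_all add: p_def algebra_simps)
  have "0 < p - x" "0 < y - p"
    unfolding px yp using s xy by simp_all
  then have xpy: "x < p" "p < y"
    by simp_all
  obtain u v w where u: "u \<in> {a..b}" "X u = x" and v: "v \<in> {a..b}" "X v = p"
      and w: "w \<in> {a..b}" "X w = y"
    using surj[of x] surj[of p] surj[of y] xy xpy by auto
  have uv: "u < v" and vw: "v < w"
    using inc[of v u] inc[of w v] u v w xpy by (force simp: not_less le_less)+
  obtain \<xi> where \<xi>: "u < \<xi>" "\<xi> < v" "F v - F u = m \<xi> * (X v - X u)"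
    by (rule cauchy_mean_value[of u v F X m X'])
       (use uv u v dX dF pos in \<open>auto intro: continuous_on_subset[OF cF] continuous_on_subset[OF cX]\<close>)
  obtain \<eta> where \<eta>: "v < \<eta>" "\<eta> < w" "F w - F v = m \<eta> * (X w - X v)"
    by (rule cauchy_mean_value[of v w F X m X'])
       (use vw v w dX dF pos in \<open>auto intro: continuous_on_subset[OF cF] continuous_on_subset[OF cX]\<close>)
  have "m \<xi> \<le> m \<eta>"
    by (rule mono_onD[OF mono]) (use \<xi> \<eta> u v w in auto)
  then have slopes: "0 \<le> (s * (1 - s) * (y - x)) * (m \<eta> - m \<xi>)"
    using s xy by simp
  have Gpx: "G p - G x = m \<xi> * (s * (y - x))" and Gyp: "G y - G p = m \<eta> * ((1 - s) * (y - x))"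
    using \<xi>(3) \<eta>(3) G u v w px yp by metis+
  have "(1 - s) * G x + s * G y - G p = s * (G y - G p) - (1 - s) * (G p - G x)"
    by (simp add: algebra_simps)
  then have "(1 - s) * G x + s * G y - G p = (s * (1 - s) * (y - x)) * (m \<eta> - m \<xi>)"
    unfolding Gpx Gyp by (simp add: algebra_simps)
  with slopes have "0 \<le> (1 - s) * G x + s * G y - G p"
    by simp
  then show "G ((1 - s) *\<^sub>R x + s *\<^sub>R y) \<le> (1 - s) * G x + s * G y"
    by (simp add: p_def)
qed simp

section \<open>Hyperbolic functions, \<open>artanh\<close>, and continuity of
  \<open>x * ln x\<close>\<close>

lemma exp_artanh:
  fixes t :: real
  assumes "\<bar>t\<bar> < 1"
  shows "exp (artanh t) = sqrt (1 + t) / sqrt (1 - t)"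
proof -
  have "artanh t = ln (sqrt ((1 + t) / (1 - t)))"
    using assms by (simp add: artanh_def ln_sqrt)
  then show ?thesis
    using assms by (simp add: real_sqrt_divide)
qed

lemma
  fixes t :: real
  assumes "\<bar>t\<bar> < 1"
  shows cosh_artanh: "cosh (artanh t) = 1 / sqrt (1 - t\<^sup>2)"
    and sinh_artanh: "sinh (artanh t) = t / sqrt (1 - t\<^sup>2)"
proof -
  define a b where "a = sqrt (1 + t)" and "b = sqrt (1 - t)"
  have ab: "a > 0" "b > 0" "a\<^sup>2 = 1 + t" "b\<^sup>2 = 1 - t"
    using assms by (simp_all add: a_def b_def)
  have s: "sqrt (1 - t\<^sup>2) = a * b"
    by (simp add: a_def b_def power2_eq_square algebra_simps flip: real_sqrt_mult)
  have e: "exp (artanh t) = a / b" "exp (- artanh t) = b / a"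
    using exp_artanh[OF assms] by (simp_all add: exp_minus a_def b_def)
  have "cosh (artanh t) = (a\<^sup>2 + b\<^sup>2) / 2 / (a * b)"
    using ab(1,2) by (simp add: cosh_def e field_simps power2_eq_square)
  then show "cosh (artanh t) = 1 / sqrt (1 - t\<^sup>2)"
    by (simp add: s ab)
  have "sinh (artanh t) = (a\<^sup>2 - b\<^sup>2) / 2 / (a * b)"
    using ab(1,2) by (simp add: sinh_def e field_simps power2_eq_square)
  then show "sinh (artanh t) = t / sqrt (1 - t\<^sup>2)"
    by (simp add: s ab)
qed

lemma artanh_strict_mono_on: "strict_mono_on {-1<..<1} (artanh :: real \<Rightarrow> real)"
proof (rule strict_mono_onI)
  fix s t :: real
  assume st: "s \<in> {-1<..<1}" "t \<in> {-1<..<1}" "s < t"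
  show "artanh s < artanh t"
  proof (rule DERIV_pos_imp_increasing[OF \<open>s < t\<close>])
    fix x assume "s \<le> x" "x \<le> t"
    then have "\<bar>x\<bar> < 1"
      using st by auto
    then show "\<exists>y. (artanh has_real_derivative y) (at x) \<and> y > 0"
      by (intro exI[of _ "1 / (1 - x\<^sup>2)"])
         (auto intro: artanh_real_has_field_derivative simp: abs_square_less_1)
  qed
qed

text \<open>Monotone l'Hopital: the derivatives of numerator and denominator have quotient
  \<open>cosh\<close>, which increases on the positive axis.\<close>

lemma sinh_over_strict_mono_on: "strict_mono_on {0<..} (\<lambda>u::real. sinh u / u)"
proof (rule strict_mono_onI)
  fix x y :: real
  assume xy: "x \<in> {0<..}" "y \<in> {0<..}" "x < y"
  show "sinh x / x < sinh y / y"
    by (rule monotone_lhopital[where a = 0 and r = cosh and g' = "\<lambda>_. 1"])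
       (use xy in \<open>auto intro!: continuous_intros derivative_eq_intros strict_mono_onI
          simp: cosh_real_nonneg_less_iff\<close>)
qed

text \<open>The derivative of \<open>sinh u / u\<close>, divided once more by \<open>u\<close>. The
  extra division appears when the slope is differentiated with respect to the entropy, whose
  derivative in \<open>t\<close> is \<open>u = artanh t\<close>.\<close>

definition sinh_gap :: "real \<Rightarrow> real" where
  "sinh_gap u = (u * cosh u - sinh u) / u ^ 3"

text \<open>The derivatives of numerator and denominator are \<open>u * sinh u\<close> and
  \<open>3 * u^2\<close>. Their quotient is a third of \<open>sinh u / u\<close>, already known to
  increase.\<close>

lemma sinh_gap_strict_mono_on: "strict_mono_on {0<..} sinh_gap"
proof (rule strict_mono_onI)
  fix x y :: real
  assume xy: "x \<in> {0<..}" "y \<in> {0<..}" "x < y"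
  show "sinh_gap x < sinh_gap y"
    unfolding sinh_gap_def
  proof (rule monotone_lhopital[where a = 0 and r = "\<lambda>u. sinh u / u / 3" and g' = "\<lambda>u. 3 * u\<^sup>2"])
    show "strict_mono_on {0<..<y} (\<lambda>u. sinh u / u / 3)"
      by (intro strict_mono_onI divide_strict_right_mono strict_mono_onD[OF sinh_over_strict_mono_on])
         auto
    show "((\<lambda>u. u * cosh u - sinh u) has_real_derivative sinh t / t / 3 * (3 * t\<^sup>2)) (at t)"
      if "0 < t" for t
      by (rule derivative_eq_intros refl)+ (use that in \<open>simp add: field_simps power2_eq_square\<close>)
  qed (use xy in \<open>auto intro!: continuous_intros derivative_eq_intros\<close>)
qed

lemma sinh_gap_pos:
  assumes "u > 0"
  shows "sinh_gap u > 0"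
proof -
  have "sinh 0 - 0 * cosh 0 > sinh u - u * cosh u"
  proof (rule DERIV_neg_imp_decreasing_open[OF assms])
    show "\<exists>y. ((\<lambda>u. sinh u - u * cosh u) has_real_derivative y) (at x) \<and> y < 0"
      if "0 < x" for x :: real
      by (rule exI[of _ "- (x * sinh x)"]) (use that in \<open>auto intro!: derivative_eq_intros\<close>)
  qed (auto intro!: continuous_intros)
  then show ?thesis
    using assms by (simp add: sinh_gap_def)
qed

text \<open>At \<open>0\<close> the product takes the value \<open>0\<close>, which is also its
  limit from the right. This yields continuity of the entropy up to the endpoint
  \<open>t = 1\<close>.\<close>

lemma continuous_on_mult_ln: "continuous_on {0..} (\<lambda>x::real. x * ln x)"
  unfolding continuous_on_def
proof
  fix x :: real
  assume "x \<in> {0..}"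
  show "((\<lambda>x. x * ln x) \<longlongrightarrow> x * ln x) (at x within {0..})"
  proof (cases "x = 0")
    case True
    have "((\<lambda>x::real. x * ln x) \<longlongrightarrow> 0) (at_right 0)"
      by real_asymp
    then show ?thesis
      using True by (simp add: at_within_Ici_at_right)
  next
    case False
    then show ?thesis
      using \<open>x \<in> {0..}\<close> by (auto intro!: tendsto_intros)
  qed
qed

section \<open>The shape of the constant\<close>

text \<open>Substituting \<open>h = (1 - t) / 2\<close> turns \<open>ln 2 - H h\<close> into \<open>entropy_gap t\<close> and
  \<open>2 - 4 * sqrt (h * (1 - h))\<close> into \<open>energy_gap t\<close>.\<close>

definition entropy_gap :: "real \<Rightarrow> real" where
  "entropy_gap t = ((1 + t) * ln (1 + t) + (1 - t) * ln (1 - t)) / 2"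

definition energy_gap :: "real \<Rightarrow> real" where
  "energy_gap t = 2 - 2 * sqrt (1 - t\<^sup>2)"

text \<open>The first and second derivative of \<open>energy_gap\<close> with respect to \<open>entropy_gap\<close>.\<close>

definition gap_slope :: "real \<Rightarrow> real" where
  "gap_slope t = 2 * (sinh (artanh t) / artanh t)"

definition gap_curvature :: "real \<Rightarrow> real" where
  "gap_curvature t = 2 * sinh_gap (artanh t) * (cosh (artanh t))\<^sup>2"

section \<open>Derivatives and monotonicity in the parameter \<open>t\<close>\<close>

lemma artanh_pos:
  fixes t :: real
  assumes "0 < t" "t < 1"
  shows "artanh t > 0"
  using strict_mono_onD[OF artanh_strict_mono_on, of 0 t] assms by simp

lemma entropy_gap_simps [simp]: "entropy_gap 0 = 0" "entropy_gap 1 = ln 2"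
  by (simp_all add: entropy_gap_def)

lemma energy_gap_simps [simp]: "energy_gap 0 = 0" "energy_gap 1 = 2"
  by (simp_all add: energy_gap_def)

lemma continuous_on_entropy_gap: "continuous_on {0..1} entropy_gap"
proof -
  have "continuous_on {0..1} (\<lambda>t::real. (1 + t) * ln (1 + t))"
    by (rule continuous_on_compose2[OF continuous_on_mult_ln]) (auto intro!: continuous_intros)
  moreover have "continuous_on {0..1} (\<lambda>t::real. (1 - t) * ln (1 - t))"
    by (rule continuous_on_compose2[OF continuous_on_mult_ln]) (auto intro!: continuous_intros)
  ultimately show ?thesis
    unfolding entropy_gap_def by (intro continuous_on_divide continuous_on_add continuous_on_const) simp_all
qed

lemma continuous_on_energy_gap: "continuous_on A energy_gap"
  unfolding energy_gap_def by (intro continuous_intros)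

lemma has_derivative_entropy_gap:
  assumes "\<bar>t\<bar> < 1"
  shows "(entropy_gap has_real_derivative artanh t) (at t)"
proof -
  have "((\<lambda>t. ((1 + t) * ln (1 + t) + (1 - t) * ln (1 - t)) / 2) has_real_derivative
      (ln (1 + t) - ln (1 - t)) / 2) (at t)"
    by (rule derivative_eq_intros refl | use assms in force)+
  moreover have "1 + t > 0" "1 - t > 0"
    using assms by auto
  ultimately show ?thesis
    by (simp add: entropy_gap_def[abs_def] artanh_def ln_div)
qed

lemma has_derivative_energy_gap:
  assumes "0 < t" "t < 1"
  shows "(energy_gap has_real_derivative gap_slope t * artanh t) (at t)"
proof -
  have "1 - t\<^sup>2 > 0"
    using assms by (simp add: power_less_one_iff)
  then have "((\<lambda>t. 2 - 2 * sqrt (1 - t\<^sup>2)) has_real_derivative 2 * (t / sqrt (1 - t\<^sup>2))) (at t)"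
    by (auto intro!: derivative_eq_intros simp: field_simps)
  then show ?thesis
    using assms artanh_pos[OF assms]
    by (simp add: energy_gap_def[abs_def] gap_slope_def sinh_artanh)
qed

text \<open>Chain rule through \<open>u = artanh t\<close>, where
  \<open>du/dt = 1 / (1 - t^2)\<close> equals the square of \<open>cosh u\<close>.\<close>

lemma has_derivative_gap_slope:
  assumes "0 < t" "t < 1"
  shows "(gap_slope has_real_derivative gap_curvature t * artanh t) (at t)"
proof -
  have u: "artanh t > 0"
    by (rule artanh_pos) fact+
  have "1 - t\<^sup>2 > 0"
    using assms by (simp add: power_less_one_iff)
  then have c: "(cosh (artanh t))\<^sup>2 = 1 / (1 - t\<^sup>2)"
    using assms by (simp add: cosh_artanh power_divide)
  have "((\<lambda>u. 2 * (sinh u / u)) has_real_derivative 2 * sinh_gap (artanh t) * artanh t) (at (artanh t))"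
    using u by (auto intro!: derivative_eq_intros simp: sinh_gap_def field_simps power2_eq_square power3_eq_cube)
  from DERIV_chain2[OF this artanh_real_has_field_derivative[of t]] show ?thesis
    using assms by (simp add: gap_slope_def[abs_def] gap_curvature_def c mult_ac)
qed

text \<open>Both \<open>sinh_gap\<close> and the square of \<open>cosh\<close> are positive and
  increasing in \<open>u = artanh t\<close>, and \<open>u\<close> increases with
  \<open>t\<close>.\<close>

lemma gap_curvature_strict_mono_on: "strict_mono_on {0<..<1} gap_curvature"
proof (rule strict_mono_onI)
  fix s t :: real
  assume st: "s \<in> {0<..<1}" "t \<in> {0<..<1}" "s < t"
  define u v where "u = artanh s" and "v = artanh t"
  have "0 < u" "u < v"
    using artanh_pos[of s] strict_mono_onD[OF artanh_strict_mono_on, of s t] st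
    by (simp_all add: u_def v_def)
  moreover from this have "sinh_gap u < sinh_gap v"
    by (intro strict_mono_onD[OF sinh_gap_strict_mono_on]) auto
  moreover have "(cosh u)\<^sup>2 < (cosh v)\<^sup>2"
    using \<open>0 < u\<close> \<open>u < v\<close> by (intro power_strict_mono) (auto simp: cosh_real_nonneg_less_iff)
  ultimately have "sinh_gap u * (cosh u)\<^sup>2 < sinh_gap v * (cosh v)\<^sup>2"
    using sinh_gap_pos[of u] by (intro mult_strict_mono) auto
  then show "gap_curvature s < gap_curvature t"
    by (simp add: gap_curvature_def u_def v_def)
qed

lemma gap_slope_strict_mono_on: "strict_mono_on {0<..<1} gap_slope"
proof (rule strict_mono_onI)
  fix s t :: real
  assume st: "s \<in> {0<..<1}" "t \<in> {0<..<1}" "s < t"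
  then have "sinh (artanh s) / artanh s < sinh (artanh t) / artanh t"
    using artanh_pos[of s] strict_mono_onD[OF artanh_strict_mono_on, of s t]
    by (intro strict_mono_onD[OF sinh_over_strict_mono_on]) auto
  then show "gap_slope s < gap_slope t"
    by (simp add: gap_slope_def)
qed

lemma entropy_gap_less:
  assumes "0 \<le> s" "s < t" "t \<le> 1"
  shows "entropy_gap s < entropy_gap t"
proof (rule DERIV_pos_imp_increasing_open[OF \<open>s < t\<close>])
  show "\<exists>y. (entropy_gap has_real_derivative y) (at x) \<and> y > 0" if "s < x" "x < t" for x
    using has_derivative_entropy_gap[of x] artanh_pos[of x] that assms by force
  show "continuous_on {s..t} entropy_gap"
    by (rule continuous_on_subset[OF continuous_on_entropy_gap]) (use assms in auto)
qed

lemma entropy_gap_pos: "0 < t \<Longrightarrow> t \<le> 1 \<Longrightarrow> entropy_gap t > 0"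
  using entropy_gap_less[of 0 t] by simp

lemma entropy_gap_image: "entropy_gap ` {0..1} = {0..ln 2}"
proof
  show "entropy_gap ` {0..1} \<subseteq> {0..ln 2}"
    using entropy_gap_less[of 0] entropy_gap_less[of _ 1] by (force simp: le_less)
  show "{0..ln 2} \<subseteq> entropy_gap ` {0..1}"
  proof
    fix x :: real
    assume "x \<in> {0..ln 2}"
    then show "x \<in> entropy_gap ` {0..1}"
      using IVT'[OF _ _ _ continuous_on_entropy_gap, of x] by force
  qed
qed

text \<open>The numerator \<open>x * \<Phi>' - \<Phi>\<close> of the derivative of
  \<open>\<Phi> / x\<close>. Geometrically, minus the intercept at \<open>x = 0\<close> of the
  tangent to the graph of \<open>\<Phi>\<close>.\<close>

definition gap_tangent :: "real \<Rightarrow> real" where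
  "gap_tangent t = entropy_gap t * gap_slope t - energy_gap t"

text \<open>The interval is open at \<open>1\<close> because \<open>gap_slope\<close> is unbounded
  there. At \<open>0\<close> the quotient in \<open>gap_slope\<close> is a division by zero, but the
  factor \<open>entropy_gap 0 = 0\<close> gives the product the correct limit value.\<close>

lemma continuous_on_gap_tangent: "continuous_on {0..<1} gap_tangent"
  unfolding continuous_on_def
proof
  fix t :: real
  assume t: "t \<in> {0..<1}"
  show "(gap_tangent \<longlongrightarrow> gap_tangent t) (at t within {0..<1})"
  proof (cases "t = 0")
    case True
    \<comment> \<open>\<open>gap_tangent\<close> with all definitions expanded to elementary
      functions, the form in which \<open>real_asymp\<close> can find the limit.\<close>
    have "((\<lambda>t::real. ((1 + t) * ln (1 + t) + (1 - t) * ln (1 - t)) / 2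
        * (2 * (t / sqrt (1 - t\<^sup>2) / (ln ((1 + t) / (1 - t)) / 2)))
        - (2 - 2 * sqrt (1 - t\<^sup>2))) \<longlongrightarrow> 0) (at_right 0)"
      by real_asymp
    moreover have "\<forall>\<^sub>F t in at_right 0. ((1 + t) * ln (1 + t) + (1 - t) * ln (1 - t)) / 2
        * (2 * (t / sqrt (1 - t\<^sup>2) / (ln ((1 + t) / (1 - t)) / 2)))
        - (2 - 2 * sqrt (1 - t\<^sup>2)) = gap_tangent t"
      using eventually_at_right_less[of 0] eventually_at_right_real[of 0 1]
      by (auto elim!: eventually_elim2 simp: gap_tangent_def entropy_gap_def energy_gap_def
          gap_slope_def sinh_artanh) (simp add: artanh_def)
    ultimately have "(gap_tangent \<longlongrightarrow> 0) (at_right 0)"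
      by (rule Lim_transform_eventually)
    then have "(gap_tangent \<longlongrightarrow> 0) (at 0 within {0..})"
      by (simp add: at_within_Ici_at_right)
    then have "(gap_tangent \<longlongrightarrow> 0) (at 0 within {0..<1})"
      by (rule tendsto_within_subset) auto
    then show ?thesis
      by (simp add: True gap_tangent_def)
  next
    case False
    then have "isCont gap_slope t" "isCont entropy_gap t" "isCont energy_gap t"
      using has_derivative_gap_slope[of t] has_derivative_entropy_gap[of t]
        has_derivative_energy_gap[of t] t by (auto intro: DERIV_isCont)
    then have "isCont gap_tangent t"
      unfolding gap_tangent_def by (intro continuous_intros)
    then show ?thesis
      by (simp add: continuous_at tendsto_within_subset[where S = UNIV])
  qed
qed

text \<open>Differentiating the factor \<open>entropy_gap\<close> in the product gives
  \<open>artanh t * gap_slope t\<close>, which cancels the derivative of \<open>energy_gap\<close>.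
  Only the curvature term survives.\<close>

lemma has_derivative_gap_tangent:
  assumes "0 < t" "t < 1"
  shows "(gap_tangent has_real_derivative entropy_gap t * (gap_curvature t * artanh t)) (at t)"
  unfolding gap_tangent_def
  by (rule derivative_eq_intros has_derivative_gap_slope has_derivative_entropy_gap
      has_derivative_energy_gap refl | use assms in force)+

text \<open>\<open>logsob_C\<close> pulled back along \<open>entropy_gap\<close>, with the limit as
  its value at \<open>0\<close>.\<close>

definition gap_ratio :: "real \<Rightarrow> real" where
  "gap_ratio t = (if t = 0 then 2 else energy_gap t / entropy_gap t)"

text \<open>The derivative of \<open>gap_ratio\<close> with respect to \<open>entropy_gap\<close>,
  not with respect to \<open>t\<close>.\<close>

definition gap_ratio_slope :: "real \<Rightarrow> real" where
  "gap_ratio_slope t = gap_tangent t / (entropy_gap t)\<^sup>2"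

text \<open>The source of convexity of \<open>logsob_C\<close>. Numerator and denominator vanish at
  \<open>0\<close>, and in the quotient of their derivatives \<open>entropy_gap x * artanh x\<close>
  cancels, leaving \<open>gap_curvature x / 2\<close>.\<close>

lemma gap_ratio_slope_strict_mono_on: "strict_mono_on {0<..<1} gap_ratio_slope"
proof (rule strict_mono_onI)
  fix s t :: real
  assume st: "s \<in> {0<..<1}" "t \<in> {0<..<1}" "s < t"
  show "gap_ratio_slope s < gap_ratio_slope t"
    unfolding gap_ratio_slope_def
  proof (rule monotone_lhopital[where a = 0 and r = "\<lambda>x. gap_curvature x / 2"
        and g' = "\<lambda>x. 2 * entropy_gap x * artanh x"])
    show "continuous_on {0..t} gap_tangent"
      by (rule continuous_on_subset[OF continuous_on_gap_tangent]) (use st in auto)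
    show "continuous_on {0..t} (\<lambda>x. (entropy_gap x)\<^sup>2)"
      by (intro continuous_intros continuous_on_subset[OF continuous_on_entropy_gap])
         (use st in auto)
    show "(gap_tangent has_real_derivative gap_curvature x / 2 * (2 * entropy_gap x * artanh x)) (at x)"
      if "0 < x" "x < t" for x
      using has_derivative_gap_tangent[of x] that st by (simp add: mult_ac)
    show "((\<lambda>x. (entropy_gap x)\<^sup>2) has_real_derivative 2 * entropy_gap x * artanh x) (at x)"
      if "0 < x" "x < t" for x
      using DERIV_power[OF has_derivative_entropy_gap[of x], of 2] that st by (simp add: mult_ac)
    show "0 < 2 * entropy_gap x * artanh x" if "0 < x" "x < t" for x
      using entropy_gap_pos[of x] artanh_pos[of x] that st by simp
    show "strict_mono_on {0<..<t} (\<lambda>x. gap_curvature x / 2)"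
      by (intro strict_mono_onI divide_strict_right_mono
          strict_mono_onD[OF gap_curvature_strict_mono_on]) (use st in auto)
  qed (use st in \<open>auto simp: gap_tangent_def\<close>)
qed

lemma gap_ratio_tendsto: "(gap_ratio \<longlongrightarrow> 2) (at_right 0)"
proof -
  have "((\<lambda>t::real. (2 - 2 * sqrt (1 - t\<^sup>2)) /
      (((1 + t) * ln (1 + t) + (1 - t) * ln (1 - t)) / 2)) \<longlongrightarrow> 2) (at_right 0)"
    by real_asymp
  moreover have "\<forall>\<^sub>F t in at_right 0. (2 - 2 * sqrt (1 - t\<^sup>2)) /
      (((1 + t) * ln (1 + t) + (1 - t) * ln (1 - t)) / 2) = gap_ratio t"
    using eventually_at_right_less[of 0]
    by (auto elim!: eventually_mono simp: gap_ratio_def energy_gap_def entropy_gap_def)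
  ultimately show ?thesis
    by (rule Lim_transform_eventually)
qed

lemma continuous_on_gap_ratio: "continuous_on {0..1} gap_ratio"
  unfolding continuous_on_def
proof
  fix t :: real
  assume t: "t \<in> {0..1}"
  show "(gap_ratio \<longlongrightarrow> gap_ratio t) (at t within {0..1})"
  proof (cases "t = 0")
    case True
    then show ?thesis
      using gap_ratio_tendsto by (simp add: at_within_Icc_at_right gap_ratio_def)
  next
    case False
    have "((\<lambda>t. energy_gap t / entropy_gap t) \<longlongrightarrow> energy_gap t / entropy_gap t) (at t within {0..1})"
      using continuous_on_entropy_gap continuous_on_energy_gap[of "{0..1}"] entropy_gap_pos[of t] t False
      unfolding continuous_on_def by (intro tendsto_divide) auto
    moreover have "\<forall>\<^sub>F x in at t within {0..1}. energy_gap x / entropy_gap x = gap_ratio x"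
      using eventually_neq_at_within[of 0 t "{0..1}"]
      by (auto elim!: eventually_mono simp: gap_ratio_def)
    ultimately show ?thesis
      using False by (simp add: gap_ratio_def[of t] Lim_transform_eventually)
  qed
qed

lemma has_derivative_gap_ratio:
  assumes "0 < t" "t < 1"
  shows "(gap_ratio has_real_derivative gap_ratio_slope t * artanh t) (at t)"
proof -
  have "((\<lambda>t. energy_gap t / entropy_gap t) has_real_derivative gap_ratio_slope t * artanh t) (at t)"
    by (rule derivative_eq_intros has_derivative_entropy_gap has_derivative_energy_gap refl
        | use assms entropy_gap_pos[of t] in force)+
       (use entropy_gap_pos[of t] assms in
         \<open>simp add: gap_ratio_slope_def gap_tangent_def field_simps power2_eq_square\<close>)
  moreover have "\<forall>\<^sub>F x in nhds t. gap_ratio x = energy_gap x / entropy_gap x"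
    using t1_space_nhds[of t 0] assms by (auto elim!: eventually_mono simp: gap_ratio_def)
  ultimately show ?thesis
    by (subst DERIV_cong_ev[OF refl _ refl])
qed

text \<open>Between positive parameters this is monotone l'Hopital with derivative quotient
  \<open>gap_slope\<close>. The left endpoint is reached through the limit \<open>2\<close>.\<close>

lemma gap_ratio_less:
  assumes "0 \<le> s" "s < t" "t \<le> 1"
  shows "gap_ratio s < gap_ratio t"
proof -
  have pos: "gap_ratio x < gap_ratio y" if "0 < x" "x < y" "y \<le> 1" for x y
  proof -
    have "energy_gap x / entropy_gap x < energy_gap y / entropy_gap y"
    proof (rule monotone_lhopital[where a = 0 and r = gap_slope and g' = artanh])
      show "continuous_on {0..y} entropy_gap"
        by (rule continuous_on_subset[OF continuous_on_entropy_gap]) (use that in auto)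
      show "strict_mono_on {0<..<y} gap_slope"
        using that by (intro strict_mono_onI strict_mono_onD[OF gap_slope_strict_mono_on]) auto
    qed (use that in \<open>auto intro: continuous_on_energy_gap has_derivative_energy_gap
        has_derivative_entropy_gap artanh_pos\<close>)
    then show ?thesis
      using that by (simp add: gap_ratio_def)
  qed
  have "2 \<le> gap_ratio x" if "0 < x" "x \<le> 1" for x
  proof (rule tendsto_upperbound[OF gap_ratio_tendsto])
    show "\<forall>\<^sub>F y in at_right 0. gap_ratio y \<le> gap_ratio x"
      using eventually_at_right_real[OF \<open>0 < x\<close>]
      by (rule eventually_mono) (use pos that in force)
  qed simp
  \<comment> \<open>The limit gives only a weak inequality. The intermediate point
    \<open>t / 2\<close> makes it strict.\<close>
  from this[of "t / 2"] have "gap_ratio 0 < gap_ratio t" if "s = 0"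
    using pos[of "t / 2" t] that assms by (simp add: gap_ratio_def[of 0])
  then show ?thesis
    using pos[of s t] assms by (cases "s = 0") auto
qed

section \<open>Return from the parameter \<open>t\<close> to the inverse entropy and
  \<open>logsob_C\<close>\<close>

lemma nat_entropy_half:
  assumes "0 \<le> t" "t \<le> 1"
  shows "nat_entropy ((1 - t) / 2) = ln 2 - entropy_gap t"
proof (cases "t = 1")
  case True
  then show ?thesis
    by (simp add: nat_entropy_def)
next
  case False
  have h: "1 - (1 - t) / 2 = (1 + t) / 2"
    by (simp add: field_simps)
  show ?thesis
    unfolding nat_entropy_def h entropy_gap_def using assms False
    by (simp add: ln_div field_simps)
qed

lemma nat_entropy_inv_gap:
  assumes "0 \<le> t" "t \<le> 1"
  shows "nat_entropy_inv (ln 2 - entropy_gap t) = (1 - t) / 2"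
proof -
  have "inj_on nat_entropy {0..1/2}"
  proof (rule linorder_inj_onI')
    fix x y :: real
    assume xy: "x \<in> {0..1/2}" "y \<in> {0..1/2}" "x < y"
    have "nat_entropy x = ln 2 - entropy_gap (1 - 2 * x)" "nat_entropy y = ln 2 - entropy_gap (1 - 2 * y)"
      using nat_entropy_half[of "1 - 2 * x"] nat_entropy_half[of "1 - 2 * y"] xy by auto
    then show "nat_entropy x \<noteq> nat_entropy y"
      using entropy_gap_less[of "1 - 2 * y" "1 - 2 * x"] xy by simp
  qed
  then show ?thesis
    unfolding nat_entropy_inv_def
    by (rule the_inv_into_f_eq) (use assms nat_entropy_half in auto)
qed

lemma logsob_C_entropy_gap:
  assumes "0 \<le> t" "t \<le> 1"
  shows "logsob_C (entropy_gap t) = gap_ratio t"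
proof (cases "t = 0")
  case False
  then have pos: "entropy_gap t > 0"
    using assms entropy_gap_pos by simp
  have "(1 - t) / 2 * (1 - (1 - t) / 2) = (1 - t\<^sup>2) / 4"
    by (simp add: field_simps power2_eq_square)
  then have "sqrt ((1 - t) / 2 * (1 - (1 - t) / 2)) = sqrt (1 - t\<^sup>2) / 2"
    by (simp only: real_sqrt_divide real_sqrt_four)
  then show ?thesis
    using pos False
    unfolding logsob_C_def gap_ratio_def energy_gap_def nat_entropy_inv_gap[OF assms]
    by (simp add: field_simps)
qed (simp add: logsob_C_def gap_ratio_def)

lemma convex_on_logsob_C: "convex_on {0..ln 2} logsob_C"
proof -
  have "convex_on {entropy_gap 0..entropy_gap 1} logsob_C"
  proof (rule convex_on_parametric[where a = 0 and b = 1 and X = entropy_gap and F = gap_ratio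
        and X' = artanh and m = gap_ratio_slope])
    show "mono_on {0<..<1} gap_ratio_slope"
      by (rule strict_mono_on_imp_mono_on[OF gap_ratio_slope_strict_mono_on])
  qed (auto intro: continuous_on_entropy_gap continuous_on_gap_ratio has_derivative_entropy_gap
      has_derivative_gap_ratio artanh_pos logsob_C_entropy_gap)
  then show ?thesis
    by simp
qed

lemma strict_mono_on_logsob_C: "strict_mono_on {0..ln 2} logsob_C"
proof (rule strict_mono_onI)
  fix x y :: real
  assume xy: "x \<in> {0..ln 2}" "y \<in> {0..ln 2}" "x < y"
  then obtain s t where st: "s \<in> {0..1}" "t \<in> {0..1}" "x = entropy_gap s" "y = entropy_gap t"
    unfolding entropy_gap_image[symmetric] by blast
  have "s < t"
    using entropy_gap_less[of t s] st \<open>x < y\<close> by (cases s t rule: linorder_cases) auto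
  then show "logsob_C x < logsob_C y"
    using st gap_ratio_less by (simp add: logsob_C_entropy_gap)
qed

lemma logsob_C_image: "logsob_C ` {0..ln 2} = {2..2 / ln 2}"
proof -
  have ends: "gap_ratio 0 = 2" "gap_ratio 1 = 2 / ln 2"
    by (simp_all add: gap_ratio_def)
  have "logsob_C ` {0..ln 2} = gap_ratio ` {0..1}"
    unfolding entropy_gap_image[symmetric] image_image by (simp add: logsob_C_entropy_gap)
  also have "\<dots> = {2..2 / ln 2}"
  proof
    show "gap_ratio ` {0..1} \<subseteq> {2..2 / ln 2}"
      using gap_ratio_less[of 0] gap_ratio_less[of _ 1] ends by (force simp: le_less)
    show "{2..2 / ln 2} \<subseteq> gap_ratio ` {0..1}"
    proof
      fix x :: real
      assume "x \<in> {2..2 / ln 2}"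
      then show "x \<in> gap_ratio ` {0..1}"
        using IVT'[OF _ _ _ continuous_on_gap_ratio, of x] ends by force
    qed
  qed
  finally show ?thesis .
qed

text \<open>An increasing function whose image is an interval cannot jump, so the limit at
  \<open>0\<close> follows from monotonicity and the image.\<close>

lemma logsob_C_tendsto: "(logsob_C \<longlongrightarrow> 2) (at_right 0)"
proof (rule decreasing_tendsto)
  have range: "\<forall>\<^sub>F x in at_right 0. x \<in> {0<..<ln 2 :: real}"
    by (rule eventually_at_right_real) simp
  then show "\<forall>\<^sub>F x in at_right 0. 2 \<le> logsob_C x"
    by (rule eventually_mono) (use logsob_C_image in fastforce)
  fix z :: real
  assume "2 < z"
  \<comment> \<open>A target value strictly between \<open>2\<close> and \<open>z\<close>. The
    minimum keeps it in the image of \<open>logsob_C\<close> when \<open>z\<close> is large.\<close>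
  then have "min ((2 + z) / 2) (2 / ln 2) \<in> {2..2 / ln 2}"
    using ln_2_less_1 by (simp add: field_simps)
  then obtain y where y: "y \<in> {0..ln 2}" "logsob_C y = min ((2 + z) / 2) (2 / ln 2)"
    unfolding logsob_C_image[symmetric] by (metis imageE)
  have "logsob_C y > logsob_C 0"
    using y \<open>2 < z\<close> ln_2_less_1 by (simp add: logsob_C_def[of 0] field_simps)
  then have "y > 0"
    using y by (cases "y = 0") auto
  have "logsob_C y < z"
    using y \<open>2 < z\<close> by (simp add: min_def)
  show "\<forall>\<^sub>F x in at_right 0. logsob_C x < z"
    using eventually_at_right_real[OF \<open>y > 0\<close>]
  proof (rule eventually_mono)
    fix x
    assume "x \<in> {0<..<y}"
    then have "logsob_C x < logsob_C y"
      using y by (intro strict_mono_onD[OF strict_mono_on_logsob_C]) auto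
    with \<open>logsob_C y < z\<close> show "logsob_C x < z"
      by simp
  qed
qed

section \<open>The inequality on the cube\<close>

lemma logsob_C_nonneg: "x \<in> {0..ln 2} \<Longrightarrow> logsob_C x \<ge> 0"
  using imageI[of x "{0..ln 2}" logsob_C] unfolding logsob_C_image by simp

text \<open>A product of two nonnegative nondecreasing convex functions is convex.\<close>

lemma convex_on_mult_logsob_C: "convex_on {0..ln 2} (\<lambda>x. x * logsob_C x)"
proof (rule convex_on_mul)
  show "mono_on {0..ln 2} logsob_C"
    by (rule strict_mono_on_imp_mono_on[OF strict_mono_on_logsob_C])
qed (auto simp: convex_on_ident convex_on_logsob_C logsob_C_nonneg mono_on_def)

text \<open>For \<open>w > 0\<close> the term \<open>e * logsob_C (e / w)\<close> is the perspective
  \<open>w * \<Phi> (e / w)\<close>, and the claim is convexity of \<open>\<Phi>\<close> with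
  weights proportional to \<open>w\<close> and \<open>w'\<close>. If a weight is \<open>0\<close>,
  the bounds force its entropy to be \<open>0\<close>, and its term vanishes.\<close>

lemma perspective_subadditive:
  assumes e: "0 \<le> e" "e \<le> w * ln 2" and e': "0 \<le> e'" "e' \<le> w' * ln 2"
  shows "(e + e') * logsob_C ((e + e') / (w + w')) \<le> e * logsob_C (e / w) + e' * logsob_C (e' / w')"
proof -
  have nonneg: "0 \<le> w" "0 \<le> w'"
    using order_trans[OF e] order_trans[OF e'] by (simp_all add: zero_le_mult_iff)
  consider "w = 0" | "w' = 0" | "w > 0" "w' > 0"
    using nonneg by fastforce
  then show ?thesis
  proof cases
    case 3
    define s where "s = w' / (w + w')"
    have s: "0 \<le> s" "s \<le> 1" "1 - s = w / (w + w')"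
      using 3 by (simp_all add: s_def field_simps)
    have x: "e / w \<in> {0..ln 2}" "e' / w' \<in> {0..ln 2}"
      using 3 e e' by (simp_all add: field_simps)
    have p: "(1 - s) * (e / w) + s * (e' / w') = (e + e') / (w + w')"
      unfolding s(3) using 3 by (simp add: s_def add_divide_distrib)
    have "(e + e') / (w + w') * logsob_C ((e + e') / (w + w'))
        \<le> (1 - s) * (e / w * logsob_C (e / w)) + s * (e' / w' * logsob_C (e' / w'))"
      using convex_onD[OF convex_on_mult_logsob_C s(1,2) x] p by simp
    also have "\<dots> = (e * logsob_C (e / w) + e' * logsob_C (e' / w')) / (w + w')"
      unfolding s(3) using 3 by (simp add: s_def add_divide_distrib)
    finally show ?thesis
      using 3 by (simp add: divide_le_cancel)
  qed (use e e' in auto)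
qed

text \<open>Here \<open>\<alpha>\<close> and \<open>\<beta>\<close> are the squares of the two
  values of a function, and the right-hand side is the square of
  \<open>sqrt \<alpha> - sqrt \<beta>\<close>. By homogeneity, \<open>\<alpha> = w * (1 + t)\<close>
  and \<open>\<beta> = w * (1 - t)\<close> reduce entropy and energy to \<open>w\<close> times
  \<open>entropy_gap t\<close> and \<open>energy_gap t\<close>. The bounds on \<open>e\<close> are
  those demanded by \<open>perspective_subadditive\<close>.\<close>

lemma two_point_entropy_le:
  fixes \<alpha> \<beta> w e :: real
  assumes "0 \<le> \<beta>" "\<beta> \<le> \<alpha>" and w_eq: "w = (\<alpha> + \<beta>) / 2"
    and e_eq: "e = (\<alpha> * ln \<alpha> + \<beta> * ln \<beta>) / 2 - w * ln w"
  shows "0 \<le> e \<and> e \<le> w * ln 2 \<and> e * logsob_C (e / w) = \<alpha> + \<beta> - 2 * sqrt (\<alpha> * \<beta>)"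
proof (cases "w = 0")
  case True
  then have "\<alpha> = 0" "\<beta> = 0"
    using assms by auto
  then show ?thesis
    using assms by simp
next
  case False
  then have w: "w > 0"
    using assms by auto
  define t where "t = (\<alpha> - \<beta>) / (2 * w)"
  have t: "0 \<le> t" "t \<le> 1"
    using assms w by (auto simp: t_def field_simps)
  have \<alpha>: "\<alpha> = w * (1 + t)" and \<beta>: "\<beta> = w * (1 - t)"
    using w w_eq by (simp_all add: t_def field_simps)
  have split: "w * x * ln (w * x) = w * x * ln w + w * (x * ln x)" if "x \<ge> 0" for x
    using w that by (cases "x = 0") (simp_all add: ln_mult algebra_simps)
  have e: "e = w * entropy_gap t"
    unfolding e_eq \<alpha> \<beta> entropy_gap_def using t
    by (simp add: split[of "1 + t"] split[of "1 - t"]) (simp add: field_simps)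
  have "\<alpha> * \<beta> = w\<^sup>2 * (1 - t\<^sup>2)"
    unfolding \<alpha> \<beta> by (simp add: power2_eq_square algebra_simps)
  then have "sqrt (\<alpha> * \<beta>) = w * sqrt (1 - t\<^sup>2)"
    using w by (simp add: real_sqrt_mult)
  moreover have "entropy_gap t * gap_ratio t = energy_gap t"
    using entropy_gap_pos[of t] t by (cases "t = 0") (auto simp: gap_ratio_def)
  then have "e * logsob_C (e / w) = w * energy_gap t"
    using w t by (simp add: e logsob_C_entropy_gap mult.assoc)
  moreover have "\<alpha> + \<beta> = 2 * w"
    using w_eq by simp
  ultimately have "e * logsob_C (e / w) = \<alpha> + \<beta> - 2 * sqrt (\<alpha> * \<beta>)"
    by (simp add: energy_gap_def algebra_simps)
  moreover have "entropy_gap t \<in> {0..ln 2}"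
    using entropy_gap_image t by auto
  ultimately show ?thesis
    using w by (simp add: e)
qed

lemma two_point_entropy:
  fixes \<alpha> \<beta> w e :: real
  assumes "0 \<le> \<alpha>" "0 \<le> \<beta>" and w_eq: "w = (\<alpha> + \<beta>) / 2"
    and e_eq: "e = (\<alpha> * ln \<alpha> + \<beta> * ln \<beta>) / 2 - w * ln w"
  shows "0 \<le> e \<and> e \<le> w * ln 2 \<and> e * logsob_C (e / w) = \<alpha> + \<beta> - 2 * sqrt (\<alpha> * \<beta>)"
proof (cases "\<beta> \<le> \<alpha>")
  case True
  then show ?thesis
    using two_point_entropy_le[of \<beta> \<alpha> w e] assms by blast
next
  case False
  have "w = (\<beta> + \<alpha>) / 2" "e = (\<beta> * ln \<beta> + \<alpha> * ln \<alpha>) / 2 - w * ln w"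
    using w_eq e_eq by (simp_all only: add.commute)
  from two_point_entropy_le[OF \<open>0 \<le> \<alpha>\<close> _ this] show ?thesis
    using False by (simp only: add.commute mult.commute)
qed

section \<open>Recursion over the dimension and the induction\<close>

definition cube_energy :: "nat \<Rightarrow> (bool list \<Rightarrow> real) \<Rightarrow> real" where
  "cube_energy n f = cube_expectation n (\<lambda>x. \<Sum>y\<in>neighbours x. (f x - f y)\<^sup>2)"

lemma cube_Suc: "cube (Suc n) = Cons False ` cube n \<union> Cons True ` cube n"
proof -
  have "x \<in> Cons False ` cube n \<union> Cons True ` cube n" if "length x = Suc n" for x
    using that by (cases x; cases "hd x") (auto simp: cube_def)
  then show ?thesis
    by (auto simp: cube_def)
qed

lemma cube_expectation_Suc:
  "cube_expectation (Suc n) g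
    = (cube_expectation n (\<lambda>x. g (False # x)) + cube_expectation n (\<lambda>x. g (True # x))) / 2"
proof -
  have "(\<Sum>x\<in>cube (Suc n). g x) = (\<Sum>x\<in>cube n. g (False # x)) + (\<Sum>x\<in>cube n. g (True # x))"
    unfolding cube_Suc by (subst sum.union_disjoint) (auto simp: sum.reindex)
  then show ?thesis
    by (simp add: cube_expectation_eq_sum field_simps)
qed

lemma adjacent_Cons:
  "adjacent (b # x) (c # y) \<longleftrightarrow> (b \<noteq> c \<and> x = y) \<or> (b = c \<and> adjacent x y)"
proof (cases "length x = length y")
  case True
  let ?D = "{i. i < length x \<and> x ! i \<noteq> y ! i}"
  have "{i. i < length (b # x) \<and> (b # x) ! i \<noteq> (c # y) ! i} = (if b = c then {} else {0}) \<union> Suc ` ?D"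
    by (auto simp: less_Suc_eq_0_disj)
  then have "card {i. i < length (b # x) \<and> (b # x) ! i \<noteq> (c # y) ! i}
      = (if b = c then 0 else 1) + card ?D"
    by (simp add: card_image)
  moreover have "card ?D = 0 \<longleftrightarrow> x = y"
    using True by (auto simp: list_eq_iff_nth_eq)
  ultimately show ?thesis
    using True by (simp add: adjacent_def)
next
  case False
  then show ?thesis
    by (auto simp: adjacent_def)
qed

lemma neighbours_Cons: "neighbours (b # x) = insert ((\<not> b) # x) (Cons b ` neighbours x)"
proof -
  have "y \<in> insert ((\<not> b) # x) (Cons b ` neighbours x)" if "adjacent (b # x) y" for y
  proof (cases y)
    case Nil
    then show ?thesis
      using that by (simp add: adjacent_def)
  next
    case (Cons c z)
    then show ?thesis
      using that by (auto simp: adjacent_Cons neighbours_def)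
  qed
  then show ?thesis
    by (auto simp: neighbours_def adjacent_Cons)
qed

lemma finite_neighbours [simp]: "finite (neighbours x)"
proof (rule finite_subset)
  show "neighbours x \<subseteq> cube (length x)"
    by (auto simp: neighbours_def adjacent_def cube_def)
qed simp

text \<open>Flipping the first bit contributes the same squared difference in both halves, so
  averaging over the halves leaves it with coefficient 1.\<close>

lemma cube_energy_Suc:
  "cube_energy (Suc n) f = (cube_energy n (\<lambda>x. f (False # x)) + cube_energy n (\<lambda>x. f (True # x))) / 2
     + cube_expectation n (\<lambda>x. (f (False # x) - f (True # x))\<^sup>2)"
proof -
  have "(\<Sum>y\<in>neighbours (b # x). (f (b # x) - f y)\<^sup>2)
      = (f (False # x) - f (True # x))\<^sup>2 + (\<Sum>y\<in>neighbours x. (f (b # x) - f (b # y))\<^sup>2)" for b x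
    unfolding neighbours_Cons
    by (cases b; subst sum.insert) (auto simp: sum.reindex power2_commute)
  then show ?thesis
    unfolding cube_energy_def cube_expectation_Suc
    by (simp add: cube_expectation_eq_sum sum.distrib field_simps)
qed

text \<open>The squared reverse triangle inequality for the L2 norm: the right-hand side is the
  square of the difference of the norms of \<open>f\<close> and \<open>g\<close>.\<close>

lemma cube_expectation_diff_square_ge:
  defines "A \<equiv> \<lambda>n g. cube_expectation n (\<lambda>x. (g x)\<^sup>2)"
  shows "cube_expectation n (\<lambda>x. (f x - g x)\<^sup>2) \<ge> A n f + A n g - 2 * sqrt (A n f * A n g)"
proof -
  let ?S = "\<Sum>x\<in>cube n. f x * g x"
  have "?S \<le> sqrt ((\<Sum>x\<in>cube n. (f x)\<^sup>2) * (\<Sum>x\<in>cube n. (g x)\<^sup>2))"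
    by (rule real_le_rsqrt) (rule Cauchy_Schwarz_ineq_sum)
  moreover have "sqrt (A n f * A n g) = sqrt ((\<Sum>x\<in>cube n. (f x)\<^sup>2) * (\<Sum>x\<in>cube n. (g x)\<^sup>2)) / 2 ^ n"
    by (simp add: A_def cube_expectation_eq_sum real_sqrt_divide real_sqrt_mult)
  ultimately have "?S / 2 ^ n \<le> sqrt (A n f * A n g)"
    by (simp add: divide_right_mono)
  moreover have "cube_expectation n (\<lambda>x. (f x - g x)\<^sup>2) = A n f + A n g - 2 * (?S / 2 ^ n)"
    by (simp add: A_def cube_expectation_eq_sum power2_diff sum.distrib sum_subtractf
        sum_distrib_left mult.assoc add_divide_distrib diff_divide_distrib)
  ultimately show ?thesis
    by simp
qed

lemma cube_expectation_nonneg: "(\<And>x. g x \<ge> 0) \<Longrightarrow> cube_expectation n g \<ge> 0"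
  by (simp add: cube_expectation_eq_sum sum_nonneg)

text \<open>By Cauchy-Schwarz the energy in the first direction dominates the two-point energy of the
  root mean squares of the two halves, whose entropy is what the chain rule for entropy adds.\<close>

lemma cube_log_sobolev:
  fixes f :: "bool list \<Rightarrow> real"
  defines "A \<equiv> \<lambda>n f. cube_expectation n (\<lambda>x. (f x)\<^sup>2)" and "E \<equiv> \<lambda>n f. cube_Ent n (\<lambda>x. (f x)\<^sup>2)"
  shows "0 \<le> E n f \<and> E n f \<le> real n * A n f * ln 2
    \<and> E n f * logsob_C (E n f / (real n * A n f)) \<le> cube_energy n f"
\<comment> \<open>The bounds on the entropy are carried along because
  \<open>perspective_subadditive\<close> requires them. The induction can start at
  \<open>n = 0\<close>, where entropy and energy both vanish.\<close>
proof (induction n arbitrary: f)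
  case 0
  have "neighbours [] = {}"
    by (auto simp: neighbours_def adjacent_def)
  moreover have "cube 0 = {[]}"
    by (auto simp: cube_def)
  ultimately show ?case
    by (simp add: A_def E_def cube_Ent_def cube_energy_def cube_expectation_eq_sum)
next
  case (Suc n)
  define f0 f1 where "f0 = (\<lambda>x. f (False # x))" and "f1 = (\<lambda>x. f (True # x))"
  define \<alpha> \<beta> w where "\<alpha> = A n f0" and "\<beta> = A n f1" and "w = (\<alpha> + \<beta>) / 2"
  define e where "e = (\<alpha> * ln \<alpha> + \<beta> * ln \<beta>) / 2 - w * ln w"
  have nonneg: "\<alpha> \<ge> 0" "\<beta> \<ge> 0"
    by (simp_all add: \<alpha>_def \<beta>_def A_def cube_expectation_nonneg)
  have A_Suc: "A (Suc n) f = w"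
    by (simp add: A_def w_def \<alpha>_def \<beta>_def f0_def f1_def cube_expectation_Suc)
  have E_Suc: "E (Suc n) f = (E n f0 / 2 + E n f1 / 2) + e"
    using A_Suc unfolding E_def cube_Ent_def e_def A_def[symmetric]
    by (simp add: cube_expectation_Suc \<alpha>_def \<beta>_def A_def f0_def f1_def field_simps)
  note two = two_point_entropy[OF nonneg w_def e_def]
  \<comment> \<open>Halving entropy and weight together leaves their quotient unchanged, and the
    halved weights of \<open>f0\<close> and \<open>f1\<close> add up to
    \<open>real n * w\<close>.\<close>
  have halves: "E n g / 2 * logsob_C (E n g / 2 / (real n * A n g / 2)) \<le> cube_energy n g / 2"
      "0 \<le> E n g / 2" "E n g / 2 \<le> real n * A n g / 2 * ln 2" for g
    using Suc.IH[of g] by simp_all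
  have sum_w: "real n * A n f0 / 2 + real n * A n f1 / 2 = real n * w"
    by (simp add: w_def \<alpha>_def \<beta>_def field_simps)
  have range: "0 \<le> E n f0 / 2 + E n f1 / 2" "E n f0 / 2 + E n f1 / 2 \<le> real n * w * ln 2"
    using halves(2,3)[of f0] halves(2,3)[of f1] by (simp_all add: sum_w[symmetric] distrib_right)
  have total: "real n * w + w = real (Suc n) * w"
    by (simp add: distrib_right)
  \<comment> \<open>Subadditivity is used twice: here to separate the new direction, of weight
    \<open>w\<close>, from the other \<open>n\<close> directions, and next to separate the two
    halves within those.\<close>
  have "E (Suc n) f * logsob_C (E (Suc n) f / (real (Suc n) * A (Suc n) f))
      \<le> (E n f0 / 2 + E n f1 / 2) * logsob_C ((E n f0 / 2 + E n f1 / 2) / (real n * w))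
        + e * logsob_C (e / w)"
    unfolding E_Suc A_Suc total[symmetric] using perspective_subadditive[OF range] two by blast
  also have "(E n f0 / 2 + E n f1 / 2) * logsob_C ((E n f0 / 2 + E n f1 / 2) / (real n * w))
      \<le> cube_energy n f0 / 2 + cube_energy n f1 / 2"
    using perspective_subadditive[OF halves(2,3)[of f0] halves(2,3)[of f1]] halves(1)[of f0] halves(1)[of f1]
    unfolding sum_w by linarith
  also have "e * logsob_C (e / w) \<le> cube_expectation n (\<lambda>x. (f0 x - f1 x)\<^sup>2)"
    using two cube_expectation_diff_square_ge[of n f0 f1] by (simp add: \<alpha>_def \<beta>_def A_def)
  also have "cube_energy n f0 / 2 + cube_energy n f1 / 2 + cube_expectation n (\<lambda>x. (f0 x - f1 x)\<^sup>2)
      = cube_energy (Suc n) f"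
    by (simp add: cube_energy_Suc f0_def f1_def add_divide_distrib)
  finally have "E (Suc n) f * logsob_C (E (Suc n) f / (real (Suc n) * A (Suc n) f))
      \<le> cube_energy (Suc n) f"
    by simp
  moreover have "0 \<le> E (Suc n) f" "E (Suc n) f \<le> real (Suc n) * A (Suc n) f * ln 2"
    using range two unfolding E_Suc A_Suc total[symmetric] by (simp_all add: distrib_right)
  ultimately show ?case
    by blast
qed

theorem theorem1p2:
  fixes n :: nat and f :: "bool list \<Rightarrow> real" and \<rho> :: real
  assumes "n \<ge> 1"
    and "\<exists>x\<in>cube n. f x \<noteq> 0"
    and "\<rho> = 1 / real n * (cube_Ent n (\<lambda>x. (f x)\<^sup>2) / cube_expectation n (\<lambda>x. (f x)\<^sup>2))"
  shows "\<rho> \<in> {0..ln 2}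
    \<and> cube_expectation n (\<lambda>x. \<Sum>y\<in>neighbours x. (f x - f y)\<^sup>2)
        \<ge> logsob_C \<rho> * cube_Ent n (\<lambda>x. (f x)\<^sup>2)
    \<and> (logsob_C \<longlongrightarrow> 2) (at_right 0)
    \<and> strict_mono_on {0..ln 2} logsob_C
    \<and> convex_on {0..ln 2} logsob_C
    \<and> logsob_C ` {0..ln 2} = {2..2 / ln 2}"
proof -
  have "(\<Sum>x\<in>cube n. (f x)\<^sup>2) > 0"
    using assms(2) by (auto intro: sum_pos2)
  then have pos: "real n * cube_expectation n (\<lambda>x. (f x)\<^sup>2) > 0"
    using assms(1) by (simp add: cube_expectation_eq_sum)
  have \<rho>: "\<rho> = cube_Ent n (\<lambda>x. (f x)\<^sup>2) / (real n * cube_expectation n (\<lambda>x. (f x)\<^sup>2))"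
    using assms(3) by simp
  have "\<rho> \<in> {0..ln 2}"
    using cube_log_sobolev[of n f] pos unfolding \<rho> by (simp add: field_simps)
  moreover have "logsob_C \<rho> * cube_Ent n (\<lambda>x. (f x)\<^sup>2)
      \<le> cube_expectation n (\<lambda>x. \<Sum>y\<in>neighbours x. (f x - f y)\<^sup>2)"
    using cube_log_sobolev[of n f] unfolding \<rho> cube_energy_def by (simp add: mult.commute)
  ultimately show ?thesis
    using logsob_C_tendsto strict_mono_on_logsob_C convex_on_logsob_C logsob_C_image by blast
qed

end
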